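(* Let $T$ be the complete theory of a $D$-set augmented with unary predicates, and suppose $T$ has quantifier elimination. Then $T$ is dp-minimal. In particular, every countable proper ultrahomogeneous colored $D$-set has a dp-minimal theory.
   Context: A $D$-set is a set $\Omega$ with a quaternary relation $D$, written $D(wx;yz)$, such that for all $w,x,y,z\in\Omega$: (D1) $D(wx;yz)\to (D(xw;yz)\wedge D(yz;wx))$; (D2) $D(wx;yz)\to\neg D(wy;xz)$; (D3) $D(wx;yz)\to\forall v\,(D(vx;yz)\vee D(wx;yv))$; (D4) $(w\neq y\wedge x\neq y)\to D(wx;yy)$. It is proper if $|\Omega|\ge 3$ and whenever $w,x,y$ are pairwise distinct there is $z\neq y$ with $D(wx;yz)$. A colored $D$-set is a $D$-set with finitely many unary predicates $P_1,\dots,P_n$ partitioning $\Omega$ into nonempty sets. A theory $T$ is dp-minimal if for every model $\Omega$ of $T$, every pair $s_1,s_2$ of mutually indiscernible sequences in $\Omega$ and every single element $b\in\Omega$, at least one of $s_1,s_2$ is indiscernible over $b$. Ultrahomogeneous: every isomorphism between finitely generated substructures extends to an automorphism. *)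

theory Defs
  imports Main "HOL-Library.Countable_Set"
begin

text \<open>Structures for the relational language with a quaternary symbol and unary predicates
  indexed by \<open>'p\<close>. The values of the relations outside the universe are irrelevant.\<close>

record ('p, 'a) dstruct =
  univ :: "'a set"
  Drel :: "'a \<Rightarrow> 'a \<Rightarrow> 'a \<Rightarrow> 'a \<Rightarrow> bool"
  Pred :: "'p \<Rightarrow> 'a \<Rightarrow> bool"

definition D_set :: "('p, 'a) dstruct \<Rightarrow> bool" where
  "D_set M \<longleftrightarrow>
    (\<forall>w\<in>univ M. \<forall>x\<in>univ M. \<forall>y\<in>univ M. \<forall>z\<in>univ M.
      (Drel M w x y z \<longrightarrow> Drel M x w y z \<and> Drel M y z w x) \<and>
      (Drel M w x y z \<longrightarrow> \<not> Drel M w y x z) \<and>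
      (Drel M w x y z \<longrightarrow> (\<forall>v\<in>univ M. Drel M v x y z \<or> Drel M w x y v)) \<and>
      (w \<noteq> y \<and> x \<noteq> y \<longrightarrow> Drel M w x y y))"

definition proper :: "('p, 'a) dstruct \<Rightarrow> bool" where
  "proper M \<longleftrightarrow>
    (infinite (univ M) \<or> 3 \<le> card (univ M)) \<and>
    (\<forall>w\<in>univ M. \<forall>x\<in>univ M. \<forall>y\<in>univ M.
      w \<noteq> x \<and> w \<noteq> y \<and> x \<noteq> y \<longrightarrow> (\<exists>z\<in>univ M. z \<noteq> y \<and> Drel M w x y z))"

definition colored_D_set :: "('c::finite, 'a) dstruct \<Rightarrow> bool" where
  "colored_D_set M \<longleftrightarrow> D_set M \<and>
    (\<forall>c. \<exists>x\<in>univ M. Pred M c x) \<and> (\<forall>x\<in>univ M. \<exists>!c. Pred M c x)"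

definition isomorphism :: "('a \<Rightarrow> 'b) \<Rightarrow> ('p, 'a) dstruct \<Rightarrow> ('p, 'b) dstruct \<Rightarrow> bool" where
  "isomorphism f M N \<longleftrightarrow> bij_betw f (univ M) (univ N) \<and>
    (\<forall>w\<in>univ M. \<forall>x\<in>univ M. \<forall>y\<in>univ M. \<forall>z\<in>univ M.
      Drel M w x y z \<longleftrightarrow> Drel N (f w) (f x) (f y) (f z)) \<and>
    (\<forall>p. \<forall>x\<in>univ M. Pred M p x \<longleftrightarrow> Pred N p (f x))"

text \<open>The language has no function symbols, so the finitely generated substructures are the
  induced structures on finite subsets.\<close>

definition ultrahomogeneous :: "('p, 'a) dstruct \<Rightarrow> bool" where
  "ultrahomogeneous M \<longleftrightarrow>
    (\<forall>A B f. finite A \<and> A \<subseteq> univ M \<and> finite B \<and> B \<subseteq> univ M \<and>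
        isomorphism f (M\<lparr>univ := A\<rparr>) (M\<lparr>univ := B\<rparr>) \<longrightarrow>
      (\<exists>g. isomorphism g M M \<and> (\<forall>x\<in>A. g x = f x)))"

datatype 'p fm =
    Bot
  | Eq nat nat
  | D nat nat nat nat
  | P 'p nat
  | Imp "'p fm" "'p fm"
  | All nat "'p fm"

primrec fv :: "'p fm \<Rightarrow> nat set" where
  "fv Bot = {}"
| "fv (Eq i j) = {i, j}"
| "fv (D i j k l) = {i, j, k, l}"
| "fv (P p i) = {i}"
| "fv (Imp \<phi> \<psi>) = fv \<phi> \<union> fv \<psi>"
| "fv (All i \<phi>) = fv \<phi> - {i}"

primrec qfree :: "'p fm \<Rightarrow> bool" where
  "qfree Bot = True"
| "qfree (Eq i j) = True"
| "qfree (D i j k l) = True"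
| "qfree (P p i) = True"
| "qfree (Imp \<phi> \<psi>) = (qfree \<phi> \<and> qfree \<psi>)"
| "qfree (All i \<phi>) = False"

primrec sat :: "('p, 'a) dstruct \<Rightarrow> (nat \<Rightarrow> 'a) \<Rightarrow> 'p fm \<Rightarrow> bool" where
  "sat M e Bot = False"
| "sat M e (Eq i j) = (e i = e j)"
| "sat M e (D i j k l) = Drel M (e i) (e j) (e k) (e l)"
| "sat M e (P p i) = Pred M p (e i)"
| "sat M e (Imp \<phi> \<psi>) = (sat M e \<phi> \<longrightarrow> sat M e \<psi>)"
| "sat M e (All i \<phi>) = (\<forall>a\<in>univ M. sat M (e(i := a)) \<phi>)"

definition valid_in :: "('p, 'a) dstruct \<Rightarrow> 'p fm \<Rightarrow> bool" where
  "valid_in M \<phi> \<longleftrightarrow> (\<forall>e. range e \<subseteq> univ M \<longrightarrow> sat M e \<phi>)"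

definition model_of :: "('p, 'a) dstruct \<Rightarrow> 'p fm set \<Rightarrow> bool" where
  "model_of M T \<longleftrightarrow> univ M \<noteq> {} \<and> (\<forall>\<phi>\<in>T. valid_in M \<phi>)"

definition Th :: "('p, 'a) dstruct \<Rightarrow> 'p fm set" where
  "Th M = {\<phi>. fv \<phi> = {} \<and> valid_in M \<phi>}"

text \<open>The type argument is the type from which the models of \<open>T\<close> are drawn. If \<open>T = Th M\<close> with
  \<open>M\<close> a nonempty structure over that type, this is quantifier elimination in the usual sense:
  all models of \<open>T\<close> satisfy the same universal closures of biconditionals as \<open>M\<close>.\<close>

definition has_QE :: "'a itself \<Rightarrow> 'p fm set \<Rightarrow> bool" where
  "has_QE _ T \<longleftrightarrow>
    (\<forall>\<phi>. \<exists>\<psi>. qfree \<psi> \<and> fv \<psi> \<subseteq> fv \<phi> \<and>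
      (\<forall>M :: ('p, 'a) dstruct. model_of M T \<longrightarrow>
        (\<forall>e. range e \<subseteq> univ M \<longrightarrow> (sat M e \<phi> \<longleftrightarrow> sat M e \<psi>))))"

text \<open>Sequences are indexed by the natural numbers, and their entries are finite tuples of a
  common length.\<close>

definition tuple_seq :: "('p, 'a) dstruct \<Rightarrow> (nat \<Rightarrow> 'a list) \<Rightarrow> bool" where
  "tuple_seq M s \<longleftrightarrow> (\<exists>n. \<forall>i. length (s i) = n \<and> set (s i) \<subseteq> univ M)"

text \<open>Variable \<open>n\<close> is assigned the \<open>n\<close>-th entry of the list consisting of the chosen tuples of
  the sequence followed by the parameters; the condition on \<open>fv\<close> keeps the lookup in range.\<close>

definition indiscernible_over ::
    "('p, 'a) dstruct \<Rightarrow> 'a set \<Rightarrow> (nat \<Rightarrow> 'a list) \<Rightarrow> bool" where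
  "indiscernible_over M A s \<longleftrightarrow>
    (\<forall>\<phi> is js cs.
      sorted_wrt (<) is \<and> sorted_wrt (<) js \<and> length is = length js \<and> set cs \<subseteq> A \<and>
      fv \<phi> \<subseteq> {..<length (concat (map s is) @ cs)} \<longrightarrow>
      (sat M ((!) (concat (map s is) @ cs)) \<phi> \<longleftrightarrow> sat M ((!) (concat (map s js) @ cs)) \<phi>))"

definition mutually_indiscernible ::
    "('p, 'a) dstruct \<Rightarrow> (nat \<Rightarrow> 'a list) \<Rightarrow> (nat \<Rightarrow> 'a list) \<Rightarrow> bool" where
  "mutually_indiscernible M s t \<longleftrightarrow>
    indiscernible_over M (\<Union>i. set (t i)) s \<and> indiscernible_over M (\<Union>i. set (s i)) t"

text \<open>The type argument is the type from which the models of \<open>T\<close> are drawn; dp-minimality is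
  the property for all types, expressed by a free type variable.\<close>

definition dp_minimal :: "'m itself \<Rightarrow> 'p fm set \<Rightarrow> bool" where
  "dp_minimal _ T \<longleftrightarrow>
    (\<forall>(M :: ('p, 'm) dstruct) s\<^sub>1 s\<^sub>2 b.
      model_of M T \<and> tuple_seq M s\<^sub>1 \<and> tuple_seq M s\<^sub>2 \<and> mutually_indiscernible M s\<^sub>1 s\<^sub>2 \<and>
      b \<in> univ M \<longrightarrow>
      indiscernible_over M {b} s\<^sub>1 \<or> indiscernible_over M {b} s\<^sub>2)"

end

theory Submission
  imports Defs
begin

text \<open>Call a set \<open>U\<close> a half if \<open>D(pq;rs)\<close> holds for all \<open>p, q\<close> in \<open>U\<close> and \<open>r, s\<close> outside. Singletons
  and the sets \<open>{v. D(vx;yz)}\<close> are halves, and by (D2) two halves \<open>U\<close>, \<open>V\<close> never cross: one of the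
  four Boolean regions they cut out is empty. Which region is empty is a first-order property of the
  parameters. Let \<open>b\<close> break both of two mutually indiscernible sequences. By quantifier elimination
  there are instances \<open>U\<close>, \<open>U'\<close> of one family of halves over the first sequence that disagree about
  \<open>b\<close>, and likewise \<open>V\<close>, \<open>V'\<close> over the second. By mutual indiscernibility the same region is empty for
  the four pairs, but \<open>b\<close> lies in that region for one of them.

  An ultrahomogeneous structure in a finite relational language eliminates quantifiers: tuples
  satisfying the same atomic formulas are conjugate, and there are only finitely many atomic
  formulas in given variables.\<close>

subsection \<open>Satisfaction\<close>

abbreviation Neg :: "'p fm \<Rightarrow> 'p fm" where
  "Neg \<phi> \<equiv> Imp \<phi> Bot"

abbreviation Conj :: "'p fm \<Rightarrow> 'p fm \<Rightarrow> 'p fm" where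
  "Conj \<phi> \<psi> \<equiv> Neg (Imp \<phi> (Neg \<psi>))"

lemma sat_cong:
  assumes "\<And>i. i \<in> fv \<phi> \<Longrightarrow> e i = e' i"
  shows "sat M e \<phi> \<longleftrightarrow> sat M e' \<phi>"
  using assms
proof (induction \<phi> arbitrary: e e')
  case (Imp \<phi> \<psi>)
  then show ?case by (metis UnI1 UnI2 fv.simps(5) sat.simps(5))
next
  case (All i \<phi>)
  have "sat M (e(i := a)) \<phi> \<longleftrightarrow> sat M (e'(i := a)) \<phi>" for a
    by (rule All.IH) (use All.prems in auto)
  then show ?case by simp
qed auto

lemma finite_fv: "finite (fv \<phi>)"
  by (induction \<phi>) auto

lemma valid_in_All_iff: "valid_in M (All i \<phi>) \<longleftrightarrow> valid_in M \<phi>"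
proof
  assume "valid_in M (All i \<phi>)"
  then show "valid_in M \<phi>"
    unfolding valid_in_def by (metis fun_upd_triv range_subsetD sat.simps(6))
next
  assume "valid_in M \<phi>"
  then show "valid_in M (All i \<phi>)"
    unfolding valid_in_def by (auto simp: image_subset_iff)
qed

text \<open>One sentence has to serve structures over two types; a bound variable is monomorphic, hence the
  two conjuncts.\<close>

lemma closure_exists: "\<exists>\<sigma>. fv \<sigma> = {} \<and> (\<forall>M :: ('p, 'a) dstruct. valid_in M \<sigma> \<longleftrightarrow> valid_in M \<phi>)
    \<and> (\<forall>M :: ('p, 'm) dstruct. valid_in M \<sigma> \<longleftrightarrow> valid_in M \<phi>)"
proof -
  have "\<exists>\<sigma>. fv \<sigma> = fv \<phi> - V \<and> (\<forall>M :: ('p, 'a) dstruct. valid_in M \<sigma> \<longleftrightarrow> valid_in M \<phi>)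
    \<and> (\<forall>M :: ('p, 'm) dstruct. valid_in M \<sigma> \<longleftrightarrow> valid_in M \<phi>)" if "finite V" for V
    using that
  proof induction
    case empty
    then show ?case by auto
  next
    case (insert i V)
    then obtain \<sigma> where \<sigma>: "fv \<sigma> = fv \<phi> - V"
      "\<forall>M :: ('p, 'a) dstruct. valid_in M \<sigma> \<longleftrightarrow> valid_in M \<phi>"
      "\<forall>M :: ('p, 'm) dstruct. valid_in M \<sigma> \<longleftrightarrow> valid_in M \<phi>"
      by blast
    have "fv (All i \<sigma>) = fv \<phi> - insert i V"
      using \<sigma>(1) by auto
    then show ?case
      using \<sigma>(2,3) valid_in_All_iff by metis
  qed
  from this[OF finite_fv[of \<phi>]] show ?thesis by simp
qed

text \<open>\<open>Th M\<close> holds only sentences, so a formula with free variables passes to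
  \<open>M'\<close> through its universal closure.\<close>

lemma valid_in_model_of_Th:
  fixes M :: "('p, 'a) dstruct" and M' :: "('p, 'm) dstruct"
  assumes "model_of M' (Th M)" and "valid_in M \<phi>"
  shows "valid_in M' \<phi>"
  using closure_exists[of \<phi>, where 'a = 'a and 'm = 'm] assms
  unfolding model_of_def Th_def by blast

subsection \<open>Quantifier elimination\<close>

text \<open>Unlike \<open>has_QE\<close> this speaks of a single structure, so it can be carried
  from \<open>M\<close> to a model of \<open>Th M\<close> over another type.\<close>

definition eliminates_quantifiers :: "('p, 'a) dstruct \<Rightarrow> bool" where
  "eliminates_quantifiers M \<longleftrightarrow>
    (\<forall>\<phi>. \<exists>\<psi>. qfree \<psi> \<and> fv \<psi> \<subseteq> fv \<phi> \<and>
      (\<forall>e. range e \<subseteq> univ M \<longrightarrow> (sat M e \<phi> \<longleftrightarrow> sat M e \<psi>)))"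

lemma eliminates_quantifiers_if_has_QE:
  fixes M :: "('p, 'a) dstruct"
  assumes "has_QE TYPE('a) (Th M)" and "univ M \<noteq> {}"
  shows "eliminates_quantifiers M"
proof -
  have "model_of M (Th M)"
    using assms(2) unfolding model_of_def Th_def by blast
  then show ?thesis
    using assms(1) unfolding has_QE_def eliminates_quantifiers_def by meson
qed

lemma eliminates_quantifiers_model_of_Th:
  assumes "model_of M' (Th M)" and "eliminates_quantifiers M"
  shows "eliminates_quantifiers M'"
  unfolding eliminates_quantifiers_def
proof
  fix \<phi>
  obtain \<psi> where \<psi>: "qfree \<psi>" "fv \<psi> \<subseteq> fv \<phi>"
    and equiv: "\<And>e. range e \<subseteq> univ M \<Longrightarrow> sat M e \<phi> \<longleftrightarrow> sat M e \<psi>"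
    using assms(2) unfolding eliminates_quantifiers_def by meson
  have "valid_in M (Conj (Imp \<phi> \<psi>) (Imp \<psi> \<phi>))"
    using equiv unfolding valid_in_def by simp
  then have "valid_in M' (Conj (Imp \<phi> \<psi>) (Imp \<psi> \<phi>))"
    by (rule valid_in_model_of_Th[OF assms(1)])
  then have "\<forall>e. range e \<subseteq> univ M' \<longrightarrow> (sat M' e \<phi> \<longleftrightarrow> sat M' e \<psi>)"
    unfolding valid_in_def by auto
  then show "\<exists>\<psi>. qfree \<psi> \<and> fv \<psi> \<subseteq> fv \<phi> \<and>
      (\<forall>e. range e \<subseteq> univ M' \<longrightarrow> (sat M' e \<phi> \<longleftrightarrow> sat M' e \<psi>))"
    using \<psi> by blast
qed

section \<open>Quantifier elimination from ultrahomogeneity\<close>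

text \<open>Shannon expansion: by induction on \<open>F\<close>, one formula at a time is split off
  according to its truth value. This turns dependence on finitely many truth values into a
  quantifier-free definition.\<close>

lemma qfree_if_determined_by_finite:
  assumes "finite F" and "\<And>\<alpha>. \<alpha> \<in> F \<Longrightarrow> qfree \<alpha> \<and> fv \<alpha> \<subseteq> V"
    and "\<And>e e'. \<lbrakk>e \<in> E; e' \<in> E; \<forall>\<alpha>\<in>F. sat M e \<alpha> \<longleftrightarrow> sat M e' \<alpha>\<rbrakk> \<Longrightarrow> X e \<longleftrightarrow> X e'"
  shows "\<exists>\<psi>. qfree \<psi> \<and> fv \<psi> \<subseteq> V \<and> (\<forall>e\<in>E. X e \<longleftrightarrow> sat M e \<psi>)"
  using assms
proof (induction F arbitrary: X)
  case empty
  then have const: "X e \<longleftrightarrow> X e'" if "e \<in> E" "e' \<in> E" for e e'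
    using that by blast
  show ?case
  proof (cases "\<exists>e\<in>E. X e")
    case True
    then obtain e where "e \<in> E" "X e" by blast
    then have "X e'" if "e' \<in> E" for e' using const that by blast
    then show ?thesis by (intro exI[of _ "Neg Bot"]) simp
  next
    case False
    then show ?thesis by (intro exI[of _ Bot]) simp
  qed
next
  case (insert \<alpha> F)
  \<comment> \<open>\<open>Y p\<close> is what remains of \<open>X\<close> once \<alpha> has truth
    value \<open>p\<close>. It depends on \<open>e\<close> only through the formulas in
    \<open>F\<close>, so the induction hypothesis applies.\<close>
  define Y where "Y p e \<longleftrightarrow> (\<exists>e'\<in>E. (\<forall>\<beta>\<in>F. sat M e \<beta> \<longleftrightarrow> sat M e' \<beta>) \<and>
    (sat M e' \<alpha> \<longleftrightarrow> p) \<and> X e')" for p e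
  have "\<exists>\<psi>. qfree \<psi> \<and> fv \<psi> \<subseteq> V \<and> (\<forall>e\<in>E. Y p e \<longleftrightarrow> sat M e \<psi>)" for p
  proof (rule insert.IH)
    show "qfree \<beta> \<and> fv \<beta> \<subseteq> V" if "\<beta> \<in> F" for \<beta>
      using insert.prems(1) that by blast
    show "Y p e \<longleftrightarrow> Y p e'" if "\<forall>\<beta>\<in>F. sat M e \<beta> \<longleftrightarrow> sat M e' \<beta>" for e e'
      unfolding Y_def using that by simp
  qed
  then obtain \<psi> where \<psi>: "\<And>p. qfree (\<psi> p)" "\<And>p. fv (\<psi> p) \<subseteq> V"
    "\<And>p e. e \<in> E \<Longrightarrow> Y p e \<longleftrightarrow> sat M e (\<psi> p)"
    by metis
  have "X e \<longleftrightarrow> Y (sat M e \<alpha>) e" if "e \<in> E" for e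
  proof
    assume "X e"
    then show "Y (sat M e \<alpha>) e" unfolding Y_def using that by blast
  next
    assume "Y (sat M e \<alpha>) e"
    then obtain e' where "e' \<in> E" "\<forall>\<beta>\<in>insert \<alpha> F. sat M e \<beta> \<longleftrightarrow> sat M e' \<beta>" "X e'"
      unfolding Y_def by blast
    then show "X e" using insert.prems(2)[OF that] by blast
  qed
  then have "\<forall>e\<in>E. X e \<longleftrightarrow> sat M e (Conj (Imp \<alpha> (\<psi> True)) (Imp (Neg \<alpha>) (\<psi> False)))"
    using \<psi>(3) by (simp split: if_splits) (metis (full_types))
  moreover have "qfree \<alpha>" "fv \<alpha> \<subseteq> V"
    using insert.prems(1) by auto
  ultimately show ?case
    using \<psi>(1,2)
    by (intro exI[of _ "Conj (Imp \<alpha> (\<psi> True)) (Imp (Neg \<alpha>) (\<psi> False))"]) simp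
qed

lemma sat_automorphism:
  assumes g: "isomorphism g M M" and "range e \<subseteq> univ M"
  shows "sat M (g \<circ> e) \<phi> \<longleftrightarrow> sat M e \<phi>"
  using assms(2)
proof (induction \<phi> arbitrary: e)
  case (Eq i j)
  then have "e x \<in> univ M" for x by blast
  then show ?case
    using g unfolding isomorphism_def bij_betw_def inj_on_def by auto
next
  case (D i j k l)
  then have "e x \<in> univ M" for x by blast
  then show ?case
    using g unfolding isomorphism_def by simp
next
  case (P p i)
  then have "e x \<in> univ M" for x by blast
  then show ?case
    using g unfolding isomorphism_def by simp
next
  case (All i \<phi>)
  have step: "sat M ((g \<circ> e)(i := g a)) \<phi> \<longleftrightarrow> sat M (e(i := a)) \<phi>" if "a \<in> univ M" for a
  proof -
    have "(g \<circ> e)(i := g a) = g \<circ> e(i := a)" by (rule fun_upd_comp[symmetric])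
    moreover have "range (e(i := a)) \<subseteq> univ M" using All.prems that by auto
    ultimately show ?thesis using All.IH[of "e(i := a)"] by (simp only:)
  qed
  have "g ` univ M = univ M"
    using g unfolding isomorphism_def bij_betw_def by blast
  then have "sat M (g \<circ> e) (All i \<phi>) \<longleftrightarrow> (\<forall>a\<in>g ` univ M. sat M ((g \<circ> e)(i := a)) \<phi>)"
    by (simp only: sat.simps)
  also have "\<dots> \<longleftrightarrow> (\<forall>a\<in>univ M. sat M (e(i := a)) \<phi>)"
    using step by blast
  finally show ?case
    by (simp only: sat.simps)
qed auto

definition atoms :: "nat set \<Rightarrow> 'p fm set" where
  "atoms V = (\<lambda>(i, j). Eq i j) ` (V \<times> V) \<union> (\<lambda>(i, j, k, l). D i j k l) ` (V \<times> V \<times> V \<times> V) \<union>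
    (\<lambda>(p, i). P p i) ` (UNIV \<times> V)"

text \<open>Here the finiteness of the set of colors enters.\<close>

lemma finite_atoms: "finite V \<Longrightarrow> finite (atoms V :: 'c::finite fm set)"
  unfolding atoms_def by simp

text \<open>Agreement on atoms makes the map sending \<open>e i\<close> to \<open>e' i\<close> an
  isomorphism of finite substructures. An automorphism extending it preserves truth.\<close>

lemma ultrahomogeneous_sat_cong:
  assumes "ultrahomogeneous M" and ran: "range e \<subseteq> univ M" "range e' \<subseteq> univ M"
    and agree: "\<forall>\<alpha>\<in>atoms (fv \<phi>). sat M e \<alpha> \<longleftrightarrow> sat M e' \<alpha>"
  shows "sat M e \<phi> \<longleftrightarrow> sat M e' \<phi>"
proof -
  let ?V = "fv \<phi>"
  have eq: "e i = e j \<longleftrightarrow> e' i = e' j" if "i \<in> ?V" "j \<in> ?V" for i j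
  proof -
    have "Eq i j \<in> atoms ?V" using that unfolding atoms_def by auto
    then show ?thesis using agree by fastforce
  qed
  have D: "Drel M (e i) (e j) (e k) (e l) \<longleftrightarrow> Drel M (e' i) (e' j) (e' k) (e' l)"
    if "i \<in> ?V" "j \<in> ?V" "k \<in> ?V" "l \<in> ?V" for i j k l
  proof -
    have "D i j k l \<in> atoms ?V" using that unfolding atoms_def by force
    then show ?thesis using agree by fastforce
  qed
  have P: "Pred M p (e i) \<longleftrightarrow> Pred M p (e' i)" if "i \<in> ?V" for p i
  proof -
    have "P p i \<in> atoms ?V" using that unfolding atoms_def by force
    then show ?thesis using agree by fastforce
  qed
  \<comment> \<open>An element may be named by several variables; by \<open>eq\<close> the choice
    among them does not affect the value.\<close>
  define f where "f x = e' (SOME i. i \<in> ?V \<and> e i = x)" for x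
  have f: "f (e i) = e' i" if "i \<in> ?V" for i
  proof -
    have "\<exists>j. j \<in> ?V \<and> e j = e i" using that by blast
    from someI_ex[OF this] show ?thesis
      unfolding f_def using eq that by blast
  qed
  have "isomorphism f (M\<lparr>univ := e ` ?V\<rparr>) (M\<lparr>univ := e' ` ?V\<rparr>)"
    unfolding isomorphism_def bij_betw_def inj_on_def
    using f D P eq by (auto simp: image_iff)
  moreover have "e ` ?V \<subseteq> univ M" "e' ` ?V \<subseteq> univ M"
    using ran by auto
  ultimately obtain g where g: "isomorphism g M M" "\<forall>x\<in>e ` ?V. g x = f x"
    using assms(1) finite_fv unfolding ultrahomogeneous_def by (metis finite_imageI)
  have "sat M e \<phi> \<longleftrightarrow> sat M (g \<circ> e) \<phi>"
    using sat_automorphism[OF g(1) ran(1)] by simp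
  also have "\<dots> \<longleftrightarrow> sat M e' \<phi>"
    by (rule sat_cong) (use g(2) f in auto)
  finally show ?thesis .
qed

lemma eliminates_quantifiers_if_ultrahomogeneous:
  fixes M :: "('c::finite, 'a) dstruct"
  assumes "ultrahomogeneous M"
  shows "eliminates_quantifiers M"
  unfolding eliminates_quantifiers_def
proof
  fix \<phi> :: "'c fm"
  have "\<exists>\<psi>. qfree \<psi> \<and> fv \<psi> \<subseteq> fv \<phi> \<and>
      (\<forall>e\<in>{e. range e \<subseteq> univ M}. sat M e \<phi> \<longleftrightarrow> sat M e \<psi>)"
  proof (rule qfree_if_determined_by_finite[where F = "atoms (fv \<phi>)"])
    show "finite (atoms (fv \<phi>) :: 'c fm set)"
      by (simp add: finite_atoms finite_fv)
    show "qfree \<alpha> \<and> fv \<alpha> \<subseteq> fv \<phi>" if "\<alpha> \<in> atoms (fv \<phi>)" for \<alpha> :: "'c fm"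
      using that unfolding atoms_def by auto
  qed (use ultrahomogeneous_sat_cong[OF assms] in blast)
  then show "\<exists>\<psi>. qfree \<psi> \<and> fv \<psi> \<subseteq> fv \<phi> \<and>
      (\<forall>e. range e \<subseteq> univ M \<longrightarrow> (sat M e \<phi> \<longleftrightarrow> sat M e \<psi>))"
    by simp
qed

subsection \<open>Halves of a D-set\<close>

context
  fixes M :: "('p, 'a) dstruct"
  assumes D_set: "D_set M"
begin

section \<open>Symmetries and degenerate cases of the relation\<close>

lemma Drel_axioms:
  assumes "w \<in> univ M" "x \<in> univ M" "y \<in> univ M" "z \<in> univ M"
  shows "(Drel M w x y z \<longrightarrow> Drel M x w y z \<and> Drel M y z w x) \<and>
      (Drel M w x y z \<longrightarrow> \<not> Drel M w y x z) \<and>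
      (Drel M w x y z \<longrightarrow> (\<forall>v\<in>univ M. Drel M v x y z \<or> Drel M w x y v)) \<and>
      (w \<noteq> y \<and> x \<noteq> y \<longrightarrow> Drel M w x y y)"
  by (rule D_set[unfolded D_set_def, THEN bspec, OF assms(1), THEN bspec, OF assms(2),
        THEN bspec, OF assms(3), THEN bspec, OF assms(4)])

lemma Drel_commute:
  assumes "w \<in> univ M" "x \<in> univ M" "y \<in> univ M" "z \<in> univ M"
  shows "Drel M w x y z \<longleftrightarrow> Drel M x w y z" "Drel M w x y z \<longleftrightarrow> Drel M y z w x"
    "Drel M w x y z \<longleftrightarrow> Drel M w x z y"
proof -
  have left: "Drel M w' x' y' z' \<longleftrightarrow> Drel M x' w' y' z'" "Drel M w' x' y' z' \<longleftrightarrow> Drel M y' z' w' x'"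
    if "w' \<in> univ M" "x' \<in> univ M" "y' \<in> univ M" "z' \<in> univ M" for w' x' y' z'
    using Drel_axioms[of w' x' y' z'] Drel_axioms[of x' w' y' z'] Drel_axioms[of y' z' w' x'] that
    by blast+
  show "Drel M w x y z \<longleftrightarrow> Drel M x w y z" "Drel M w x y z \<longleftrightarrow> Drel M y z w x"
    using left assms by blast+
  show "Drel M w x y z \<longleftrightarrow> Drel M w x z y"
    using left(2)[of w x y z] left(1)[of y z w x] left(2)[of z y w x] assms by blast
qed

lemma Drel_not_crossing:
  assumes "w \<in> univ M" "x \<in> univ M" "y \<in> univ M" "z \<in> univ M" "Drel M w x y z"
  shows "\<not> Drel M w y x z"
  using Drel_axioms[of w x y z] assms by blast

lemma Drel_replace:
  assumes "w \<in> univ M" "x \<in> univ M" "y \<in> univ M" "z \<in> univ M" "v \<in> univ M" "Drel M w x y z"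
  shows "Drel M v x y z \<or> Drel M w x y v"
  using Drel_axioms[of w x y z] assms by blast

text \<open>If \<open>x\<close> differs from \<open>y\<close> and \<open>z\<close>, then (D4) and
  (D1) give D(xx;yz), which by (D2) excludes D(xy;xz). In the other cases (D2) makes D(xx;xz) or
  D(xx;xy) exclude itself.\<close>

lemma Drel_shared:
  assumes "x \<in> univ M" "y \<in> univ M" "z \<in> univ M"
  shows "\<not> Drel M x y x z" "\<not> Drel M x y z x" "\<not> Drel M y x x z" "\<not> Drel M y x z x"
proof -
  have *: "\<not> Drel M x y' x z'" if "y' \<in> univ M" "z' \<in> univ M" for y' z'
  proof
    assume D: "Drel M x y' x z'"
    then have "x = y' \<or> x = z'"
      using Drel_axioms[of x y' x z'] Drel_axioms[of y' z' x x] assms that by blast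
    moreover have "\<not> Drel M x x x z'" "\<not> Drel M x x x y'"
      using Drel_axioms[of x x x z'] Drel_axioms[of x x x y'] assms that by blast+
    ultimately show False
      using D Drel_axioms[of x y' x x] assms that by blast
  qed
  show "\<not> Drel M x y x z" using * assms by blast
  then show "\<not> Drel M x y z x" "\<not> Drel M y x x z" "\<not> Drel M y x z x"
    using Drel_commute(1)[of y x x z] Drel_commute(1)[of y x z x] Drel_commute(3)[of x y z x] assms
    by blast+
qed

text \<open>(D4) with (D1) gives one direction, \<open>Drel_shared\<close> the other. This makes
  singletons halves and reduces atoms with a repeated element in one pair to equality.\<close>

lemma Drel_pair:
  assumes "x \<in> univ M" "y \<in> univ M" "z \<in> univ M"
  shows "Drel M x x y z \<longleftrightarrow> x \<noteq> y \<and> x \<noteq> z"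
  using Drel_axioms[of y z x x] Drel_shared[of x x y] Drel_shared[of x x z] assms by blast

text \<open>If the conclusion failed, replacing \<open>x\<close> in the two hypotheses would give the crossing pair
  \<open>D(xp;qr)\<close> and \<open>D(xq;pr)\<close>.\<close>

lemma Drel_join:
  assumes "p \<in> univ M" "q \<in> univ M" "x \<in> univ M" "y \<in> univ M" "r \<in> univ M"
    and "Drel M x p r y" "Drel M x q r y"
  shows "Drel M p q r y"
proof (rule ccontr)
  assume neg: "\<not> ?thesis"
  then have "\<not> Drel M q p r y"
    using Drel_commute(1)[of p q r y] assms by blast
  with neg have "Drel M x p r q" "Drel M x q r p"
    using Drel_replace[of x p r y q] Drel_replace[of x q r y p] assms by blast+
  then have "Drel M x p q r" "Drel M x q p r"
    using Drel_commute(3)[of x p r q] Drel_commute(3)[of x q r p] assms by blast+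
  then show False
    using Drel_not_crossing[of x p q r] assms by blast
qed

text \<open>Only the trace on the universe counts: a set \<open>{v. Drel M v x y z}\<close> may
  contain stray elements outside \<open>univ M\<close>.\<close>

definition half :: "'a set \<Rightarrow> bool" where
  "half U \<longleftrightarrow> (\<forall>p\<in>U \<inter> univ M. \<forall>q\<in>U \<inter> univ M. \<forall>r\<in>univ M - U. \<forall>s\<in>univ M - U. Drel M p q r s)"

lemma half_singleton: "half {x}"
  unfolding half_def using Drel_pair by blast

lemma half_Drel:
  assumes "x \<in> univ M" "y \<in> univ M" "z \<in> univ M"
  shows "half {v. Drel M v x y z}"
  unfolding half_def
proof (intro ballI)
  fix p q r s
  assume p: "p \<in> {v. Drel M v x y z} \<inter> univ M" and q: "q \<in> {v. Drel M v x y z} \<inter> univ M"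
    and r: "r \<in> univ M - {v. Drel M v x y z}" and s: "s \<in> univ M - {v. Drel M v x y z}"
  \<comment> \<open>Replacing \<open>z\<close> by an outside \<open>r'\<close> in D(p'x;yz), (D3)
    leaves D(p'x;yr'), as D(r'x;yz) fails.\<close>
  have sep: "Drel M x p' r' y"
    if "p' \<in> {v. Drel M v x y z} \<inter> univ M" "r' \<in> univ M - {v. Drel M v x y z}" for p' r'
    using that assms Drel_replace[of p' x y z r'] Drel_commute(1)[of p' x y r']
      Drel_commute(3)[of x p' y r'] by blast
  have in_univ: "p \<in> univ M" "q \<in> univ M" "r \<in> univ M" "s \<in> univ M"
    using p q r s by auto
  \<comment> \<open>The first use of \<open>Drel_join\<close> trades \<open>x\<close> for the pair
    \<open>p\<close>, \<open>q\<close>; the second, with the sides exchanged, trades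
    \<open>y\<close> for \<open>r\<close>, \<open>s\<close>.\<close>
  have "Drel M p q r' y" if "r' \<in> univ M - {v. Drel M v x y z}" for r'
    using Drel_join[of p q x y r'] sep p q that assms in_univ by blast
  then have "Drel M y r p q" "Drel M y s p q"
    using r s assms in_univ Drel_commute by metis+
  then have "Drel M r s p q"
    using Drel_join[of r s y q p] assms in_univ by blast
  then show "Drel M p q r s"
    using in_univ Drel_commute by metis
qed

text \<open>Points \<open>w\<close>, \<open>x\<close>, \<open>y\<close>, \<open>z\<close> in all
  four regions would give D(wx;yz) from \<open>U\<close> and D(wy;xz) from \<open>V\<close>, against
  (D2). The truth values \<open>p\<close>, \<open>q\<close> name the empty region.\<close>

lemma halves_not_crossing:
  assumes "half U" "half V"
  shows "\<exists>p q. \<forall>v\<in>univ M. \<not> ((v \<in> U \<longleftrightarrow> p) \<and> (v \<in> V \<longleftrightarrow> q))"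
proof (rule ccontr)
  assume "\<not> ?thesis"
  then obtain w x y z where "w \<in> univ M" "x \<in> univ M" "y \<in> univ M" "z \<in> univ M"
    "w \<in> U" "w \<in> V" "x \<in> U" "x \<notin> V" "y \<notin> U" "y \<in> V" "z \<notin> U" "z \<notin> V"
    by metis
  then show False
    using assms Drel_not_crossing[of w x y z] unfolding half_def by blast
qed

end

text \<open>Makes being a D-set a property of the theory, hence of all its models. Variable 4 is the
  \<open>v\<close> of (D3); the variables stay free because \<open>valid_in\<close> ranges over all
  assignments.\<close>

lemma D_set_iff_valid_in:
  "D_set M \<longleftrightarrow> valid_in M
    (Conj (Imp (D 0 1 2 3) (Conj (D 1 0 2 3) (D 2 3 0 1)))
    (Conj (Imp (D 0 1 2 3) (Neg (D 0 2 1 3)))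
    (Conj (Imp (D 0 1 2 3) (Imp (Neg (D 4 1 2 3)) (D 0 1 2 4)))
      (Imp (Conj (Neg (Eq 0 2)) (Neg (Eq 1 2))) (D 0 1 2 2)))))"
  (is "_ \<longleftrightarrow> valid_in M ?\<phi>")
proof
  assume D: "D_set M"
  show "valid_in M ?\<phi>"
    unfolding valid_in_def
  proof (intro allI impI)
    fix e :: "nat \<Rightarrow> 'b"
    assume "range e \<subseteq> univ M"
    then have "e i \<in> univ M" for i by blast
    then show "sat M e ?\<phi>"
      using Drel_axioms[OF D, of "e 0" "e 1" "e 2" "e 3"] by simp
  qed
next
  assume valid: "valid_in M ?\<phi>"
  have "(Drel M w x y z \<longrightarrow> Drel M x w y z \<and> Drel M y z w x) \<and>
      (Drel M w x y z \<longrightarrow> \<not> Drel M w y x z) \<and>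
      (Drel M w x y z \<longrightarrow> Drel M v x y z \<or> Drel M w x y v) \<and>
      (w \<noteq> y \<and> x \<noteq> y \<longrightarrow> Drel M w x y y)"
    if "w \<in> univ M" "x \<in> univ M" "y \<in> univ M" "z \<in> univ M" "v \<in> univ M" for w x y z v
  proof -
    \<comment> \<open>The value \<open>w\<close> serves variable 0 and is the default above 4, which
      keeps the range in the universe.\<close>
    let ?e = "(\<lambda>_. w)(1 := x, 2 := y, 3 := z, 4 := v)"
    have "range ?e \<subseteq> univ M" using that by auto
    then have "sat M ?e ?\<phi>" using valid unfolding valid_in_def by blast
    then show ?thesis by simp blast
  qed
  then show "D_set M"
    unfolding D_set_def by blast
qed

subsection \<open>Definable families of halves\<close>

text \<open>A shape lists the positions of the parameters of a half in the concatenation of the chosen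
  tuples.\<close>

datatype shape = Point nat | Cone nat nat nat

primrec vars :: "shape \<Rightarrow> nat set" where
  "vars (Point i) = {i}"
| "vars (Cone i j k) = {i, j, k}"

text \<open>Places the parameters of a second half behind the \<open>n\<close> entries that carry
  the first.\<close>

primrec shift :: "nat \<Rightarrow> shape \<Rightarrow> shape" where
  "shift n (Point i) = Point (n + i)"
| "shift n (Cone i j k) = Cone (n + i) (n + j) (n + k)"

primrec shape_fm :: "nat \<Rightarrow> shape \<Rightarrow> 'p fm" where
  "shape_fm v (Point i) = Eq v i"
| "shape_fm v (Cone i j k) = D v i j k"

primrec inst :: "('p, 'a) dstruct \<Rightarrow> (nat \<Rightarrow> 'a) \<Rightarrow> shape \<Rightarrow> 'a set" where
  "inst M e (Point i) = {e i}"
| "inst M e (Cone i j k) = {v. Drel M v (e i) (e j) (e k)}"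

lemma half_inst:
  assumes "D_set M" and "e ` vars c \<subseteq> univ M"
  shows "half M (inst M e c)"
  using assms by (cases c) (auto simp: half_singleton half_Drel)

lemma sat_shape_fm: "v \<notin> vars c \<Longrightarrow> sat M (e(v := a)) (shape_fm v c) \<longleftrightarrow> a \<in> inst M e c"
  by (cases c) auto

lemma fv_shape_fm: "fv (shape_fm v c) = insert v (vars c)"
  by (cases c) auto

lemma vars_shift: "vars (shift n c) = (+) n ` vars c"
  by (cases c) auto

lemma inst_append_left: "vars c \<subseteq> {..<length L} \<Longrightarrow> inst M ((!) (L @ K)) c = inst M ((!) L) c"
  by (cases c) (auto simp: nth_append)

lemma inst_append_right: "inst M ((!) (L @ K)) (shift (length L) c) = inst M ((!) K) c"
  by (cases c) auto

lemma concat_tuple_seq: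
  assumes "tuple_seq M s"
  shows "set (concat (map s is)) \<subseteq> univ M"
    and "length is = length js \<Longrightarrow> length (concat (map s is)) = length (concat (map s js))"
proof -
  obtain n where n: "\<And>i. length (s i) = n" "\<And>i. set (s i) \<subseteq> univ M"
    using assms unfolding tuple_seq_def by blast
  show "set (concat (map s is)) \<subseteq> univ M" using n(2) by auto
  have "length (concat (map s ks)) = length ks * n" for ks
    by (induction ks) (auto simp: n(1))
  then show "length (concat (map s is)) = length (concat (map s js))" if "length is = length js"
    using that by simp
qed

text \<open>Emptiness of a region is one formula in the chosen tuples with parameters
  \<open>K\<close>. Indiscernibility moves the tuples of \<open>s\<close> while \<open>K\<close>,
  later taken from the other sequence, stays fixed.\<close>

lemma empty_region_indiscernible:
  assumes ind: "indiscernible_over M A s" and s: "tuple_seq M s"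
    and idx: "sorted_wrt (<) is" "sorted_wrt (<) js" "length is = length js"
    and K: "set K \<subseteq> A"
    and c: "vars c \<subseteq> {..<length (concat (map s is))}" and d: "vars d \<subseteq> {..<length K}"
    and empty: "\<forall>v\<in>univ M. \<not> ((v \<in> inst M ((!) (concat (map s is))) c \<longleftrightarrow> p) \<and>
      (v \<in> inst M ((!) K) d \<longleftrightarrow> q))"
  shows "\<forall>v\<in>univ M. \<not> ((v \<in> inst M ((!) (concat (map s js))) c \<longleftrightarrow> p) \<and>
      (v \<in> inst M ((!) K) d \<longleftrightarrow> q))"
proof -
  define n where "n = length (concat (map s is))"
  have n': "length (concat (map s js)) = n"
    using concat_tuple_seq(2)[OF s idx(3)] n_def by simp
  \<comment> \<open>The first index beyond the list \<open>concat (map s is) @ K\<close>, hence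
    fresh for both shapes.\<close>
  define v where "v = n + length K"
  define lit :: "bool \<Rightarrow> 'a fm \<Rightarrow> 'a fm" where "lit b \<phi> = (if b then \<phi> else Neg \<phi>)" for b \<phi>
  define \<phi> where "\<phi> = All v (Neg (Conj (lit p (shape_fm v c)) (lit q (shape_fm v (shift n d)))))"
  have v: "v \<notin> vars c" "v \<notin> vars (shift n d)"
    using c d unfolding v_def n_def vars_shift by auto
  have "sat M ((!) (L @ K)) \<phi> \<longleftrightarrow>
    (\<forall>v\<in>univ M. \<not> ((v \<in> inst M ((!) L) c \<longleftrightarrow> p) \<and> (v \<in> inst M ((!) K) d \<longleftrightarrow> q)))"
    if "length L = n" for L
    using that c inst_append_left[of c L M K] inst_append_right[of M L K d] v
    unfolding \<phi>_def lit_def n_def by (auto simp: sat_shape_fm)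
  moreover have "fv \<phi> \<subseteq> {..<length (concat (map s is) @ K)}"
    using c d unfolding \<phi>_def lit_def v_def n_def by (auto simp: fv_shape_fm vars_shift)
  then have "sat M ((!) (concat (map s is) @ K)) \<phi> \<longleftrightarrow> sat M ((!) (concat (map s js) @ K)) \<phi>"
    using ind idx K unfolding indiscernible_over_def by blast
  ultimately show ?thesis
    using n_def n' empty by simp
qed

subsection \<open>Breaking indiscernibility\<close>

text \<open>Induction reduces to atoms. Those without \<open>b\<close> are covered by
  \<open>base\<close>. A single \<open>b\<close> in \<open>Eq\<close> or \<open>D\<close> can be
  moved to the front by symmetry, where \<open>inst\<close> decides; a repeated \<open>b\<close>
  leaves only equalities or a constant truth value.\<close>

lemma sat_qfree_cong:
  assumes D: "D_set M" and b: "b \<in> univ M"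
    and L: "set L \<subseteq> univ M" "set L' \<subseteq> univ M" "length L = length L'" and cs: "set cs \<subseteq> {b}"
    and base: "\<And>\<phi>. fv \<phi> \<subseteq> {..<length L} \<Longrightarrow> sat M ((!) L) \<phi> \<longleftrightarrow> sat M ((!) L') \<phi>"
    and inst: "\<And>c. vars c \<subseteq> {..<length L} \<Longrightarrow> b \<in> inst M ((!) L) c \<longleftrightarrow> b \<in> inst M ((!) L') c"
    and "qfree \<phi>" "fv \<phi> \<subseteq> {..<length (L @ cs)}"
  shows "sat M ((!) (L @ cs)) \<phi> \<longleftrightarrow> sat M ((!) (L' @ cs)) \<phi>"
proof -
  let ?n = "length L" and ?e = "(!) (L @ cs)" and ?e' = "(!) (L' @ cs)"
  have entry: "i < ?n \<and> ?e i = L ! i \<and> ?e' i = L' ! i \<and> L ! i \<in> univ M \<and> L' ! i \<in> univ M \<or>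
      ?e i = b \<and> ?e' i = b" if "i < length (L @ cs)" for i
  proof (cases "i < ?n")
    case True
    then show ?thesis using L by (auto simp: nth_append)
  next
    case False
    then have "i - ?n < length cs" using that by simp
    then have "cs ! (i - ?n) = b" using cs nth_mem by blast
    then show ?thesis using False L(3) by (simp add: nth_append)
  qed
  have eq: "L ! i = L ! j \<longleftrightarrow> L' ! i = L' ! j" if "i < ?n" "j < ?n" for i j
    using base[of "Eq i j"] that by simp
  have Pred: "Pred M p (L ! i) \<longleftrightarrow> Pred M p (L' ! i)" if "i < ?n" for i p
    using base[of "P p i"] that by simp
  have D4: "Drel M (L ! i) (L ! j) (L ! k) (L ! l) \<longleftrightarrow> Drel M (L' ! i) (L' ! j) (L' ! k) (L' ! l)"
    if "i < ?n" "j < ?n" "k < ?n" "l < ?n" for i j k l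
    using base[of "D i j k l"] that by simp
  have point: "b = L ! i \<longleftrightarrow> b = L' ! i" "L ! i = b \<longleftrightarrow> L' ! i = b" if "i < ?n" for i
    using inst[of "Point i"] that by auto
  have cone: "Drel M b (L ! i) (L ! j) (L ! k) \<longleftrightarrow> Drel M b (L' ! i) (L' ! j) (L' ! k)"
    if "i < ?n" "j < ?n" "k < ?n" for i j k
    using inst[of "Cone i j k"] that by simp
  have in_univ: "K ! i \<in> univ M" if "set K \<subseteq> univ M" "length K = ?n" "i < ?n" for K i
    using that nth_mem by fastforce
  have one: "Drel M (K ! i) b (K ! j) (K ! k) \<longleftrightarrow> Drel M b (K ! i) (K ! j) (K ! k)"
    "Drel M (K ! i) (K ! j) b (K ! k) \<longleftrightarrow> Drel M b (K ! k) (K ! i) (K ! j)"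
    "Drel M (K ! i) (K ! j) (K ! k) b \<longleftrightarrow> Drel M b (K ! k) (K ! i) (K ! j)"
    if "set K \<subseteq> univ M" "length K = ?n" "i < ?n" "j < ?n" "k < ?n" for K i j k
    using Drel_commute[OF D] in_univ[OF that(1,2)] that(3-5) b by metis+
  have two: "Drel M b b x y \<longleftrightarrow> b \<noteq> x \<and> b \<noteq> y" "Drel M x y b b \<longleftrightarrow> b \<noteq> x \<and> b \<noteq> y"
    if "x \<in> univ M" "y \<in> univ M" for x y
    using Drel_pair[OF D b that] Drel_commute(2)[OF D that b b] by blast+
  from \<open>qfree \<phi>\<close> \<open>fv \<phi> \<subseteq> {..<length (L @ cs)}\<close> show ?thesis
  proof (induction \<phi>)
    case (Eq i j)
    then have in_range: "i < length (L @ cs)" "j < length (L @ cs)"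
      by auto
    have "?e i = ?e j \<longleftrightarrow> ?e' i = ?e' j"
      using entry[OF in_range(1)] entry[OF in_range(2)]
      by (elim disjE conjE) (simp_all only: eq point)
    then show ?case by (simp only: sat.simps)
  next
    case (P p i)
    then have in_range: "i < length (L @ cs)"
      by auto
    have "Pred M p (?e i) \<longleftrightarrow> Pred M p (?e' i)"
      using entry[OF in_range] by (elim disjE conjE) (simp_all only: Pred)
    then show ?case by (simp only: sat.simps)
  next
    case (D i j k l)
    then have in_range: "i < length (L @ cs)" "j < length (L @ cs)" "k < length (L @ cs)"
      "l < length (L @ cs)"
      by auto
    \<comment> \<open>Sixteen cases, by which of the four arguments are \<open>b\<close>.\<close>
    have "Drel M (?e i) (?e j) (?e k) (?e l) \<longleftrightarrow> Drel M (?e' i) (?e' j) (?e' k) (?e' l)"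
      using entry[OF in_range(1)] entry[OF in_range(2)] entry[OF in_range(3)] entry[OF in_range(4)]
      by (elim disjE conjE)
        (simp_all only: D4 one L cone two point Drel_shared[OF assms(1)] b)
    then show ?case by (simp only: sat.simps)
  qed auto
qed

text \<open>If no shape were broken, then by \<open>sat_qfree_cong\<close> no quantifier-free
  formula would be, and by quantifier elimination no formula at all.\<close>

lemma not_indiscernible_over_singletonE:
  assumes D: "D_set M" and QE: "eliminates_quantifiers M" and b: "b \<in> univ M"
    and s: "tuple_seq M s" and ind: "indiscernible_over M A s"
    and not_ind: "\<not> indiscernible_over M {b} s"
  obtains "is" js c where "sorted_wrt (<) is" "sorted_wrt (<) js" "length is = length js"
    "vars c \<subseteq> {..<length (concat (map s is))}"
    "b \<in> inst M ((!) (concat (map s is))) c \<longleftrightarrow> b \<notin> inst M ((!) (concat (map s js))) c"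
proof -
  obtain \<phi> "is" js cs where idx: "sorted_wrt (<) is" "sorted_wrt (<) js" "length is = length js"
    and cs: "set cs \<subseteq> {b}" and fv: "fv \<phi> \<subseteq> {..<length (concat (map s is) @ cs)}"
    and neq: "\<not> (sat M ((!) (concat (map s is) @ cs)) \<phi> \<longleftrightarrow>
      sat M ((!) (concat (map s js) @ cs)) \<phi>)"
    using not_ind unfolding indiscernible_over_def by blast
  let ?L = "concat (map s is)" and ?L' = "concat (map s js)"
  have len: "length ?L = length ?L'"
    by (rule concat_tuple_seq(2)[OF s idx(3)])
  have in_univ: "set ?L \<subseteq> univ M" "set ?L' \<subseteq> univ M"
    by (rule concat_tuple_seq(1)[OF s])+
  obtain \<psi> where \<psi>: "qfree \<psi>" "fv \<psi> \<subseteq> fv \<phi>"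
    and equiv: "\<And>e. range e \<subseteq> univ M \<Longrightarrow> sat M e \<phi> \<longleftrightarrow> sat M e \<psi>"
    using QE unfolding eliminates_quantifiers_def by meson
  have equiv_list: "sat M ((!) K) \<phi> \<longleftrightarrow> sat M ((!) K) \<psi>"
    if "set K \<subseteq> univ M" "fv \<phi> \<subseteq> {..<length K}" for K
  proof -
    \<comment> \<open>\<open>(!) K\<close> is unspecified beyond the list, while
      \<open>equiv\<close> asks for all values in the universe, so the tail is filled with
      \<open>b\<close>.\<close>
    let ?e = "\<lambda>i. if i < length K then K ! i else b"
    have "sat M ((!) K) \<phi> \<longleftrightarrow> sat M ?e \<phi>" "sat M ((!) K) \<psi> \<longleftrightarrow> sat M ?e \<psi>"
      using that(2) \<psi>(2) by (auto intro!: sat_cong)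
    moreover have "range ?e \<subseteq> univ M"
      using that(1) b by auto
    ultimately show ?thesis using equiv by simp
  qed
  have "\<not> (sat M ((!) (?L @ cs)) \<psi> \<longleftrightarrow> sat M ((!) (?L' @ cs)) \<psi>)"
  proof -
    have "set cs \<subseteq> univ M" using cs b by blast
    then have "set (?L @ cs) \<subseteq> univ M" "set (?L' @ cs) \<subseteq> univ M" using in_univ by simp_all
    moreover have "fv \<phi> \<subseteq> {..<length (?L' @ cs)}" using fv len by simp
    ultimately show ?thesis using neq equiv_list fv by blast
  qed
  moreover have base: "sat M ((!) ?L) \<theta> \<longleftrightarrow> sat M ((!) ?L') \<theta>" if "fv \<theta> \<subseteq> {..<length ?L}" for \<theta>
    using ind idx that unfolding indiscernible_over_def
    by (metis append_Nil2 empty_subsetI list.set(1))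
  ultimately obtain c where "vars c \<subseteq> {..<length ?L}"
    "b \<in> inst M ((!) ?L) c \<longleftrightarrow> b \<notin> inst M ((!) ?L') c"
    using sat_qfree_cong[OF D b in_univ len cs base, where \<phi> = \<psi>] \<psi> fv by blast
  then show thesis using that idx by blast
qed

lemma mutually_indiscernible_over_singleton:
  assumes D: "D_set M" and QE: "eliminates_quantifiers M" and b: "b \<in> univ M"
    and s: "tuple_seq M s" and t: "tuple_seq M t" and mut: "mutually_indiscernible M s t"
  shows "indiscernible_over M {b} s \<or> indiscernible_over M {b} t"
proof (rule ccontr)
  assume not_ind: "\<not> ?thesis"
  have s_ind: "indiscernible_over M (\<Union>i. set (t i)) s"
    and t_ind: "indiscernible_over M (\<Union>i. set (s i)) t"
    using mut unfolding mutually_indiscernible_def by auto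
  obtain "is" js c where idx: "sorted_wrt (<) is" "sorted_wrt (<) js" "length is = length js"
    and c: "vars c \<subseteq> {..<length (concat (map s is))}"
    and bc: "b \<in> inst M ((!) (concat (map s is))) c \<longleftrightarrow> b \<notin> inst M ((!) (concat (map s js))) c"
    using not_indiscernible_over_singletonE[OF D QE b s s_ind] not_ind by metis
  obtain ks ls d where idx': "sorted_wrt (<) ks" "sorted_wrt (<) ls" "length ks = length ls"
    and d: "vars d \<subseteq> {..<length (concat (map t ks))}"
    and bd: "b \<in> inst M ((!) (concat (map t ks))) d \<longleftrightarrow> b \<notin> inst M ((!) (concat (map t ls))) d"
    using not_indiscernible_over_singletonE[OF D QE b t t_ind] not_ind by metis
  define U where "U is = inst M ((!) (concat (map s is))) c" for "is"
  define V where "V is = inst M ((!) (concat (map t is))) d" for "is"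
  \<comment> \<open>One pair fixes the empty region; indiscernibility then carries it to the other
    three.\<close>
  have "half M (U is)" "half M (V ks)"
    unfolding U_def V_def
    using concat_tuple_seq(1)[OF s, of "is"] concat_tuple_seq(1)[OF t, of ks] c d nth_mem
    by (intro half_inst[OF D]; blast)+
  from halves_not_crossing[OF D this] obtain p q
    where empty: "\<forall>v\<in>univ M. \<not> ((v \<in> U is \<longleftrightarrow> p) \<and> (v \<in> V ks \<longleftrightarrow> q))"
    by (elim exE)
  have change_s: "\<forall>v\<in>univ M. \<not> ((v \<in> U js \<longleftrightarrow> p) \<and> (v \<in> V ks' \<longleftrightarrow> q))"
    if "\<forall>v\<in>univ M. \<not> ((v \<in> U is \<longleftrightarrow> p) \<and> (v \<in> V ks' \<longleftrightarrow> q))" "length ks = length ks'" for ks'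
    unfolding U_def V_def
  proof (rule empty_region_indiscernible[OF s_ind s idx _ c])
    show "set (concat (map t ks')) \<subseteq> (\<Union>i. set (t i))" by auto
    show "vars d \<subseteq> {..<length (concat (map t ks'))}"
      using d unfolding concat_tuple_seq(2)[OF t that(2)] .
  qed (rule that(1)[unfolded U_def V_def])
  \<comment> \<open>Here \<open>t\<close> moves and \<open>s\<close> is fixed, so the two conjuncts
    exchange places.\<close>
  have "\<forall>v\<in>univ M. \<not> ((v \<in> V ls \<longleftrightarrow> q) \<and> (v \<in> U is \<longleftrightarrow> p))"
    unfolding U_def V_def
  proof (rule empty_region_indiscernible[OF t_ind t idx' _ d c])
    show "set (concat (map s is)) \<subseteq> (\<Union>i. set (s i))" by auto
  qed (use empty in \<open>simp only: U_def V_def conj_commute\<close>)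
  then have empty': "\<forall>v\<in>univ M. \<not> ((v \<in> U is \<longleftrightarrow> p) \<and> (v \<in> V ls \<longleftrightarrow> q))"
    by (simp only: conj_commute)
  \<comment> \<open>\<open>b\<close> agrees with \<open>p\<close> on exactly one of
    \<open>U is\<close>, \<open>U js\<close> and with \<open>q\<close> on exactly one of
    \<open>V ks\<close>, \<open>V ls\<close>; that pair puts \<open>b\<close> in the empty
    region.\<close>
  show False
    using bspec[OF empty b] bspec[OF empty' b] bspec[OF change_s[OF empty refl] b]
      bspec[OF change_s[OF empty' idx'(3)] b] bc bd
    unfolding U_def[symmetric] V_def[symmetric] by argo
qed

section \<open>From a structure to all models of its theory\<close>

lemma dp_minimal_Th:
  fixes M :: "('p, 'a) dstruct"
  assumes "D_set M" and "univ M \<noteq> {} \<Longrightarrow> eliminates_quantifiers M"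
  shows "dp_minimal TYPE('m) (Th M)"
  unfolding dp_minimal_def
proof (intro allI impI, elim conjE)
  fix M' :: "('p, 'm) dstruct" and s t b
  assume M': "model_of M' (Th M)" and st: "tuple_seq M' s" "tuple_seq M' t"
    "mutually_indiscernible M' s t" and b: "b \<in> univ M'"
  \<comment> \<open>An empty structure admits no assignment, so \<open>Bot\<close> is valid in it
    and its theory has no nonempty model.\<close>
  have "univ M \<noteq> {}"
  proof
    assume "univ M = {}"
    then have "valid_in M Bot" unfolding valid_in_def by auto
    then have "valid_in M' Bot" by (rule valid_in_model_of_Th[OF M'])
    moreover have "range (\<lambda>_ :: nat. b) \<subseteq> univ M'" using b by simp
    ultimately show False unfolding valid_in_def by (metis sat.simps(1))
  qed
  then have "eliminates_quantifiers M'"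
    using eliminates_quantifiers_model_of_Th[OF M'] assms(2) by blast
  moreover have "D_set M'"
    using valid_in_model_of_Th[OF M'] assms(1) unfolding D_set_iff_valid_in by blast
  ultimately show "indiscernible_over M' {b} s \<or> indiscernible_over M' {b} t"
    by (intro mutually_indiscernible_over_singleton[OF _ _ b st])
qed

theorem theorem2:
  fixes M :: "('p, 'a) dstruct"
    and N :: "('c::finite, 'b) dstruct"
  shows "(D_set M \<and> has_QE TYPE('a) (Th M) \<longrightarrow> dp_minimal TYPE('m) (Th M)) \<and>
    (countable (univ N) \<and> colored_D_set N \<and> proper N \<and> ultrahomogeneous N \<longrightarrow>
      dp_minimal TYPE('m) (Th N))"
proof (intro conjI impI; elim conjE)
  assume "D_set M" "has_QE TYPE('a) (Th M)"
  then show "dp_minimal TYPE('m) (Th M)"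
    by (intro dp_minimal_Th eliminates_quantifiers_if_has_QE)
next
  assume "colored_D_set N" "ultrahomogeneous N"
  then show "dp_minimal TYPE('m) (Th N)"
    unfolding colored_D_set_def
    by (intro dp_minimal_Th eliminates_quantifiers_if_ultrahomogeneous) (elim conjE)
qed

end
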